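(* Let $q$ be a prime power and let $n,k,s,t,g,h,l$ be positive integers with $\gcd(n,s)=\gcd(n,t)=1$ and $s\equiv lt\pmod n$. Let $\eta,\theta\in\mathbb{F}_{q^n}$ satisfy $N_{q^{sn}/q^s}(\eta)\neq(-1)^{nk}$ and $N_{q^{tn}/q^t}(\theta)\neq(-1)^{nk}$. Assume $s\not\equiv\pm t\pmod n$. (a) If $\eta=\theta=0$ and $1<k<n-1$, then $\mathcal{H}_{k,s}(\eta,g)$ and $\mathcal{H}_{k,t}(\theta,h)$ are not equivalent. (b) If $\eta=0$, $\theta\neq0$ and $2<k<n-2$, then $\mathcal{H}_{k,s}(\eta,g)$ and $\mathcal{H}_{k,t}(\theta,h)$ are not equivalent. (c) If $\eta\neq0$, $\theta\neq0$ and $2<k<n-2$, then $\mathcal{H}_{k,s}(\eta,g)$ and $\mathcal{H}_{k,t}(\theta,h)$ are not equivalent.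
   Context: All polynomials are $q$-polynomials over $\mathbb{F}_{q^n}$, i.e. $\sum_{i=0}^{n-1}a_ix^{q^i}$ with $a_i\in\mathbb{F}_{q^n}$, considered modulo $x^{q^n}-x$. $N_{q^{sn}/q^s}(\eta)=\eta^{1+q^s+\dots+q^{s(n-1)}}$. For integers $k,s,h$ and $\eta\in\mathbb{F}_{q^n}$, $\mathcal{H}_{k,s}(\eta,h)=\{a_0x+a_1x^{q^s}+\dots+a_{k-1}x^{q^{s(k-1)}}+\eta a_0^{q^h}x^{q^{sk}} : a_0,\dots,a_{k-1}\in\mathbb{F}_{q^n}\}$. Two sets $\mathcal{C},\mathcal{C}'$ of $q$-polynomials over $\mathbb{F}_{q^n}$ are equivalent if there exist permutation $q$-polynomials $L_1,L_2$ (inducing bijections of $\mathbb{F}_{q^n}$) and $\rho\in\mathrm{Aut}(\mathbb{F}_q)$ with $\mathcal{C}'=\{L_1\circ f^\rho\circ L_2: f\in\mathcal{C}\}$, where $(\sum a_ix^{q^i})^\rho:=\sum a_i^\rho x^{q^i}$. *)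

theory Defs
  imports
    "HOL-Computational_Algebra.Polynomial"
    "HOL-Number_Theory.Cong"
    "HOL-Number_Theory.Prime_Powers"
    "HOL-Library.Cardinality"
begin

text \<open>
  Throughout, the finite field with \<open>q ^ n\<close> elements is a type \<open>'a\<close> of sort \<open>{field, finite}\<close>
  with \<open>CARD('a) = q ^ n\<close>; its subfield with \<open>q\<close> elements is the set of roots of \<open>x ^ q - x\<close>.
  Classes modulo \<open>x ^ (q ^ n) - x\<close> are represented by their reduced representatives.
\<close>

definition field_poly :: "nat \<Rightarrow> nat \<Rightarrow> 'a::field poly" where
  "field_poly q n = monom 1 (q ^ n) - monom 1 1"

definition q_polys :: "nat \<Rightarrow> nat \<Rightarrow> 'a::field poly set" where
  "q_polys q n = {\<Sum>i<n. monom (a i) (q ^ i) | a. True}"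

definition perm_q_polys :: "nat \<Rightarrow> nat \<Rightarrow> 'a::field poly set" where
  "perm_q_polys q n = {L \<in> q_polys q n. bij (poly L)}"

text \<open>The norm \<open>N\<^bsub>q^(s n)/q^s\<^esub>(x) = x ^ (1 + q^s + \<dots> + q^(s (n - 1)))\<close>.\<close>

definition q_norm :: "nat \<Rightarrow> nat \<Rightarrow> nat \<Rightarrow> 'a::field \<Rightarrow> 'a" where
  "q_norm q n s x = x ^ (\<Sum>i<n. q ^ (s * i))"

text \<open>The reduction matters here: the exponents \<open>q ^ (s * i)\<close> may exceed \<open>q ^ (n - 1)\<close>.\<close>

definition H_code :: "nat \<Rightarrow> nat \<Rightarrow> nat \<Rightarrow> nat \<Rightarrow> 'a::field \<Rightarrow> nat \<Rightarrow> 'a poly set" where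
  "H_code q n k s \<eta> h =
     {((\<Sum>i<k. monom (a i) (q ^ (s * i))) + monom (\<eta> * a 0 ^ (q ^ h)) (q ^ (s * k)))
        mod field_poly q n | a. True}"

definition subfield_q :: "nat \<Rightarrow> 'a::field set" where
  "subfield_q q = {x. x ^ q = x}"

definition field_automorphism_on :: "'a::field set \<Rightarrow> ('a \<Rightarrow> 'a) \<Rightarrow> bool" where
  "field_automorphism_on K \<rho> \<longleftrightarrow> bij_betw \<rho> K K \<and>
     (\<forall>x\<in>K. \<forall>y\<in>K. \<rho> (x + y) = \<rho> x + \<rho> y \<and> \<rho> (x * y) = \<rho> x * \<rho> y)"

text \<open>
  An automorphism \<open>\<rho>\<close> of the subfield with \<open>q\<close> elements acts on coefficients in the large field
  through an extension \<open>\<sigma>\<close> of \<open>\<rho>\<close> to an automorphism of the large field. The choice of extension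
  does not affect the relation: two extensions differ by a map \<open>x \<mapsto> x ^ (q ^ j)\<close>, whose action on
  the coefficients of a \<open>q\<close>-polynomial is composition on the left with the monomial of exponent
  \<open>q ^ j\<close> and on the right with its inverse, and these are absorbed by \<open>L1\<close> and \<open>L2\<close>.
\<close>

definition code_equiv :: "nat \<Rightarrow> nat \<Rightarrow> 'a::field poly set \<Rightarrow> 'a poly set \<Rightarrow> bool" where
  "code_equiv q n C C' \<longleftrightarrow>
     (\<exists>L1\<in>perm_q_polys q n. \<exists>L2\<in>perm_q_polys q n. \<exists>\<rho> \<sigma>.
        field_automorphism_on (subfield_q q) \<rho> \<and>
        field_automorphism_on UNIV \<sigma> \<and> (\<forall>x\<in>subfield_q q. \<sigma> x = \<rho> x) \<and>
        C' = {pcompose L1 (pcompose (map_poly \<sigma> f) L2) mod field_poly q n | f. f \<in> C})"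

end

theory Submission
  imports Defs
begin

text \<open>
  Replacing \<open>\<eta>\<close> by a conjugate absorbs the automorphism, so an equivalence reads
  \<open>L1 \<circ> f \<circ> L2\<close> on functions. Let \<open>U\<close> be the sum in \<open>\<int>/n\<close> of the exponent sets of \<open>L1\<close> and
  \<open>L2\<close>, and rescale exponents by \<open>1/s\<close>, so that the target code lives on a progression \<open>P\<close> with
  difference \<open>r = t/s\<close>. In the image of \<open>a x^(q^(s i))\<close> the coefficient at each position is a
  \<open>q\<close>-polynomial in \<open>a\<close> whose monomials cannot cancel, so \<open>u + i \<in> P\<close> for all \<open>u \<in> U\<close> and every \<open>i\<close>
  with a free coefficient. Since \<open>r \<noteq> 1, -1\<close>, the set \<open>P\<close> is not an interval. In (a), \<open>P\<close>
  has \<open>k\<close> elements and contains an interval of length \<open>k\<close>. In (b), \<open>P\<close> has \<open>k + 1\<close> elements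
  and is a union of intervals of length \<open>k\<close>, hence an interval. In (c), the twisted
  coefficient gives \<open>u \<in> P\<close> unless \<open>u - k \<in> U\<close>, and \<open>u + k \<in> P\<close> unless \<open>u + k \<in> U\<close>; so some \<open>u\<close> and
  \<open>u + k\<close> lie in \<open>U\<close>, and then \<open>P\<close> has more than \<open>k + 1\<close> elements. For \<open>k = 3\<close> the last count
  is too small, but it excludes \<open>u - 3 \<in> U\<close>, which makes \<open>u\<close> a further element of \<open>P\<close>.
\<close>

section \<open>Frobenius powers and \<open>q\<close>-polynomial functions\<close>

lemma power_CARD_eq_self:
  fixes x :: "'a :: {field, finite}"
  shows "x ^ CARD('a) = x"
proof (cases "x = 0")
  case False
  let ?S = "UNIV - {0 :: 'a}"
  have "bij_betw ((*) x) ?S ?S"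
    by (rule bij_betwI[of _ _ _ "\<lambda>y. y / x"]) (use False in auto)
  then have "(\<Prod>y\<in>?S. x * y) = \<Prod>?S"
    by (rule prod.reindex_bij_betw)
  moreover have "(\<Prod>y\<in>?S. x * y) = x ^ card ?S * \<Prod>?S"
    by (simp add: prod.distrib)
  moreover have "\<Prod>?S \<noteq> 0" by simp
  ultimately have "x ^ card ?S = 1" by simp
  moreover have "CARD('a) = Suc (card ?S)"
    using card_Suc_Diff1[of UNIV "0 :: 'a"] by simp
  ultimately show ?thesis by (simp only: power_Suc mult_1_right)
qed (simp add: card_gt_0_iff)

lemma power_q_sum:
  fixes f :: "'b \<Rightarrow> 'a :: {field, finite}"
  assumes "primepow q" "CARD('a) = q ^ n"
  shows "(\<Sum>i\<in>E. f i) ^ (q ^ e) = (\<Sum>i\<in>E. f i ^ (q ^ e))"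
proof -
  have pr: "prime CHAR('a)"
    by (rule prime_CHAR_semidom) (simp add: finite_imp_CHAR_pos)
  obtain p m where p: "prime p" "m > 0" "q = p ^ m"
    using assms(1) by (auto simp: primepow_def)
  \<comment> \<open>Translation by 1 permutes the field, so \<open>CARD('a)\<close> is zero in it;
    hence the characteristic is the prime whose power is \<open>q\<close>.\<close>
  have "(\<Sum>y\<in>UNIV. y + 1 :: 'a) = (\<Sum>y\<in>UNIV. y)"
    by (rule sum.reindex_bij_witness[of _ "\<lambda>y. y - 1" "\<lambda>y. y + 1"]) auto
  then have "of_nat (CARD('a)) = (0 :: 'a)"
    by (simp add: sum.distrib)
  then have "CHAR('a) dvd p ^ (m * n)"
    unfolding of_nat_eq_0_iff_char_dvd by (simp add: assms(2) p(3) power_mult)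
  then have "CHAR('a) dvd p"
    using pr prime_dvd_power by blast
  then have "CHAR('a) = p"
    using pr p(1) primes_dvd_imp_eq by blast
  then have "q ^ e = CHAR('a) ^ (m * e)"
    using p by (simp add: power_mult)
  then show ?thesis
    using freshmans_dream_sum'[OF pr] by blast
qed

lemma power_q_mod:
  fixes x :: "'a :: {field, finite}"
  assumes "CARD('a) = q ^ n"
  shows "x ^ (q ^ (e mod n)) = x ^ (q ^ e)"
proof -
  have *: "x ^ ((q ^ n) ^ d) = x" for d
  proof (induction d)
    case (Suc d)
    then show ?case
      using power_CARD_eq_self[of x] by (simp only: assms power_Suc power_mult)
  qed simp
  have "q ^ e = (q ^ n) ^ (e div n) * q ^ (e mod n)"
    by (simp flip: power_mult power_add)
  then show ?thesis
    by (simp only: power_mult *)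
qed

text \<open>A \<open>q\<close>-polynomial function determines its reduced coefficients, which are the sums of
  the coefficients over exponents in one residue class modulo \<open>n\<close>.\<close>

lemma q_polynomial_support:
  fixes w :: "'b \<Rightarrow> 'a :: {field, finite}" and w' :: "'c \<Rightarrow> 'a"
  assumes q: "primepow q" and card: "CARD('a) = q ^ n" and n: "n > 0"
    and fin: "finite E" "finite E'"
    and eq: "\<And>x. (\<Sum>e\<in>E. w e * x ^ (q ^ p e)) = (\<Sum>e\<in>E'. w' e * x ^ (q ^ p' e))"
    and nz: "(\<Sum>e | e \<in> E \<and> p e mod n = r. w e) \<noteq> 0" and r: "r < n"
  obtains e where "e \<in> E'" "w' e \<noteq> 0" "p' e mod n = r"
proof -
  have q1: "q > 1" using q primepow_gt_Suc_0 by force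
  define W where "W i = (\<Sum>e | e \<in> E \<and> p e mod n = i. w e)" for i
  define W' where "W' i = (\<Sum>e | e \<in> E' \<and> p' e mod n = i. w' e)" for i
  define P where "P V = (\<Sum>i<n. monom (V i :: 'a) (q ^ i))" for V
  have val: "poly (P (\<lambda>i. \<Sum>e | e \<in> F \<and> \<pi> e mod n = i. v e)) x = (\<Sum>e\<in>F. v e * x ^ (q ^ \<pi> e))"
    if "finite F" for F :: "'d set" and \<pi> v and x :: 'a
  proof -
    have "poly (P (\<lambda>i. \<Sum>e | e \<in> F \<and> \<pi> e mod n = i. v e)) x
        = (\<Sum>i<n. \<Sum>e | e \<in> F \<and> \<pi> e mod n = i. v e * x ^ (q ^ \<pi> e))"
      unfolding P_def poly_sum poly_monom sum_distrib_right
      by (intro sum.cong refl) (auto simp: power_q_mod[OF card])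
    also have "\<dots> = (\<Sum>e\<in>F. v e * x ^ (q ^ \<pi> e))"
      by (rule sum.group) (use that n in auto)
    finally show ?thesis .
  qed
  have deg: "degree (P V) < q ^ n" for V
  proof -
    have "degree (P V) \<le> q ^ (n - 1)"
      unfolding P_def
      by (intro degree_sum_le order_trans[OF degree_monom_le] power_increasing) (use q1 in auto)
    also have "\<dots> < q ^ n" using q1 n by simp
    finally show ?thesis .
  qed
  have coeff: "coeff (P V) (q ^ r) = V r" for V
  proof -
    have "coeff (P V) (q ^ r) = (\<Sum>i<n. if i = r then V i else 0)"
      unfolding P_def coeff_sum coeff_monom using q1
      by (intro sum.cong) (auto simp: power_inject_exp)
    then show ?thesis using r by simp
  qed
  \<comment> \<open>Both polynomials have degree below \<open>q ^ n\<close>, the number of points at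
    which they agree.\<close>
  have "P W = P W'"
  proof (rule poly_eqI_degree[where A = UNIV])
    show "poly (P W) x = poly (P W') x" for x
      unfolding W_def W'_def val[OF fin(1)] val[OF fin(2)] by (rule eq)
  qed (use deg card in auto)
  then have "W' r \<noteq> 0"
    using coeff[of W] coeff[of W'] nz by (simp add: W_def)
  then obtain e where "e \<in> {e \<in> E'. p' e mod n = r}" "w' e \<noteq> 0"
    unfolding W'_def by (rule sum.not_neutral_contains_not_neutral)
  then show ?thesis using that by blast
qed

text \<open>Raising to a power of \<open>q\<close> is additive, so the composite expands into one
  monomial for each triple \<open>(i, j, m)\<close> of terms taken from the middle, outer and inner
  map.\<close>

lemma q_polynomial_composition:
  fixes c d w :: "nat \<Rightarrow> 'a :: {field, finite}"
  assumes "primepow q" "CARD('a) = q ^ n"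
  shows "(\<Sum>j<n. c j * (\<Sum>i\<in>E. w i * (\<Sum>m<n. d m * x ^ (q ^ m)) ^ (q ^ z i)) ^ (q ^ j))
    = (\<Sum>(i, j, m)\<in>E \<times> {..<n} \<times> {..<n}.
        (c j * w i ^ (q ^ j) * d m ^ (q ^ (z i + j))) * x ^ (q ^ (m + z i + j)))"
proof -
  have "(\<Sum>j<n. c j * (\<Sum>i\<in>E. w i * (\<Sum>m<n. d m * x ^ (q ^ m)) ^ (q ^ z i)) ^ (q ^ j))
    = (\<Sum>j<n. \<Sum>i\<in>E. \<Sum>m<n.
        (c j * w i ^ (q ^ j) * d m ^ (q ^ (z i + j))) * x ^ (q ^ (m + z i + j)))"
  proof (intro sum.cong refl)
    fix j
    have "(w i * (\<Sum>m<n. d m * x ^ (q ^ m)) ^ (q ^ z i)) ^ (q ^ j)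
        = (\<Sum>m<n. w i ^ (q ^ j) * d m ^ (q ^ (z i + j)) * x ^ (q ^ (m + z i + j)))" for i
    proof -
      have "(w i * (\<Sum>m<n. d m * x ^ (q ^ m)) ^ (q ^ z i)) ^ (q ^ j)
          = w i ^ (q ^ j) * (\<Sum>m<n. d m * x ^ (q ^ m)) ^ (q ^ (z i + j))"
        by (simp only: power_mult_distrib power_add power_mult)
      then show ?thesis
        by (simp only: power_q_sum[OF assms] power_mult_distrib power_add power_mult
            sum_distrib_left mult.assoc)
    qed
    then show "c j * (\<Sum>i\<in>E. w i * (\<Sum>m<n. d m * x ^ (q ^ m)) ^ (q ^ z i)) ^ (q ^ j)
        = (\<Sum>i\<in>E. \<Sum>m<n.
            (c j * w i ^ (q ^ j) * d m ^ (q ^ (z i + j))) * x ^ (q ^ (m + z i + j)))"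
      by (simp add: power_q_sum[OF assms] sum_distrib_left mult.assoc)
  qed
  also have "\<dots> = (\<Sum>i\<in>E. \<Sum>j<n. \<Sum>m<n.
        (c j * w i ^ (q ^ j) * d m ^ (q ^ (z i + j))) * x ^ (q ^ (m + z i + j)))"
    by (rule sum.swap)
  finally show ?thesis
    by (simp add: sum.cartesian_product)
qed

section \<open>Progressions and intervals modulo \<open>n\<close>\<close>

text \<open>Kept as a union of full residue classes, so that intervals of integers compare with it
  without a choice of representatives.\<close>

definition prog :: "nat \<Rightarrow> int \<Rightarrow> nat \<Rightarrow> int set" where
  "prog n r K = {y. \<exists>i<K. [y = r * int i] (mod int n)}"

lemma prog_cong: "y \<in> prog n r K \<Longrightarrow> [y = z] (mod int n) \<Longrightarrow> z \<in> prog n r K"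
  unfolding prog_def using cong_sym cong_trans by blast

lemma prog_card:
  assumes "X \<subseteq> prog n r K" "inj_on (\<lambda>x. x mod int n) X"
  shows "card X \<le> K"
proof -
  have "(\<lambda>x. x mod int n) ` X \<subseteq> (\<lambda>i. (r * int i) mod int n) ` {..<K}"
    using assms(1) by (fastforce simp: prog_def cong_def)
  then have "card ((\<lambda>x. x mod int n) ` X) \<le> card ((\<lambda>i. (r * int i) mod int n) ` {..<K})"
    by (intro card_mono) auto
  also have "\<dots> \<le> K" using card_image_le[of "{..<K}"] by fastforce
  finally show ?thesis using assms(2) by (simp add: card_image)
qed

text \<open>The progression has at most \<open>K\<close> residues, and \<open>X\<close> already uses
  \<open>K\<close> of them.\<close>

lemma prog_covered:
  assumes "X \<subseteq> prog n r K" "inj_on (\<lambda>x. x mod int n) X" "card X = K" "finite X" "y \<in> prog n r K"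
  obtains x where "x \<in> X" "[y = x] (mod int n)"
proof (rule ccontr)
  assume "\<not> thesis"
  with that have no: "y mod int n \<noteq> x mod int n" if "x \<in> X" for x
    using that by (auto simp: cong_def)
  then have "y \<notin> X" by blast
  have "inj_on (\<lambda>x. x mod int n) (insert y X)"
    using assms(2) no by auto
  then have "card (insert y X) \<le> K"
    using assms by (intro prog_card) auto
  then show False using \<open>y \<notin> X\<close> assms by simp
qed

lemma inj_on_mod_window:
  assumes "X \<subseteq> {a..<a + int n}"
  shows "inj_on (\<lambda>x. x mod int n) X"
proof (rule inj_onI)
  fix x y assume *: "x \<in> X" "y \<in> X" "x mod int n = y mod int n"
  then have "int n dvd x - y" by (simp add: mod_eq_dvd_iff)
  moreover have "x \<in> {a..<a + int n}" "y \<in> {a..<a + int n}" using * assms by blast+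
  then have "\<bar>x - y\<bar> < int n" by auto
  ultimately show "x = y" using zdvd_imp_le[of "int n" "\<bar>x - y\<bar>"] by fastforce
qed

lemma prog_card_window:
  assumes "X \<subseteq> prog n r K" "X \<subseteq> {a..<a + int n}"
  shows "card X \<le> K"
  using assms prog_card inj_on_mod_window by blast

text \<open>A set has as many \<open>x\<close> with \<open>x + 1\<close> outside as it has maximal runs. For the progression
  \<open>r * {0..<K}\<close> these are the \<open>r * i\<close> with \<open>i + l\<close> outside \<open>{0..<K}\<close>, where \<open>l\<close> inverts \<open>r\<close>; unless
  \<open>l\<close> is \<open>1\<close> or \<open>-1\<close> there are two such \<open>i\<close>, which can be chosen consecutive.\<close>

lemma prog_not_interval:
  assumes cop: "coprime r (int n)" and K: "2 \<le> K" "K + 2 \<le> n"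
    and r: "\<not> [r = 1] (mod int n)" "\<not> [r = - 1] (mod int n)"
  shows "\<not> {w..<w + int K} \<subseteq> prog n r K"
proof
  assume sub: "{w..<w + int K} \<subseteq> prog n r K"
  obtain l0 where "[r * l0 = 1] (mod int n)"
    using cong_solve_coprime_int[OF cop] by blast
  then obtain l where l: "[r * l = 1] (mod int n)" "0 \<le> l" "l < int n"
    using K that[of "l0 mod int n"] by (auto simp: cong_def mod_simps)
  have "l \<noteq> 0" using l K by (auto simp: cong_def)
  moreover have "l \<noteq> 1" using l r by auto
  moreover have "l \<noteq> int n - 1"
  proof
    assume "l = int n - 1"
    moreover have "r * (int n - 1) - - r = int n * r" by (simp add: algebra_simps)
    ultimately have "[r * l = - r] (mod int n)"
      unfolding cong_iff_dvd_diff by simp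
    then have "[- r = 1] (mod int n)" using l(1) cong_sym cong_trans by blast
    then have "[r = - 1] (mod int n)" using cong_minus_minus_iff by fastforce
    with r show False by simp
  qed
  ultimately have l2: "2 \<le> l" "l \<le> int n - 2" using l by auto
  \<comment> \<open>Modulo \<open>n\<close> the successor of \<open>r * i\<close> is
    \<open>r * (i + l)\<close>, which is outside the progression because \<open>i + l\<close> falls
    in the gap from \<open>K\<close> to \<open>n - 1\<close>. So \<open>r * i\<close> is the last
    point of the interval.\<close>
  have ends: "[r * i = w + int K - 1] (mod int n)"
    if i: "0 \<le> i" "i < int K" "i + l \<ge> int K" "i + l < int n" for i
  proof -
    have "r * i \<in> prog n r K"
      unfolding prog_def using i by (auto intro!: exI[of _ "nat i"])
    then obtain x where x: "x \<in> {w..<w + int K}" "[r * i = x] (mod int n)"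
      using prog_covered[OF sub inj_on_mod_window[of _ w]] K by auto
    have "x + 1 \<notin> prog n r K"
    proof
      assume "x + 1 \<in> prog n r K"
      moreover have "[x + 1 = r * (i + l)] (mod int n)"
        using cong_add[OF x(2) l(1)] by (simp add: algebra_simps cong_sym)
      ultimately have "r * (i + l) \<in> prog n r K" by (rule prog_cong)
      then obtain j where j: "j < K" "[r * (i + l) = r * int j] (mod int n)"
        unfolding prog_def by blast
      then have "[i + l = int j] (mod int n)"
        using cong_mult_lcancel[OF cop] by blast
      then have "i + l = int j"
        using i j K by (intro cong_less_imp_eq_int) auto
      then show False using i j by simp
    qed
    then have "x + 1 \<notin> {w..<w + int K}" using sub by blast
    then have "x = w + int K - 1" using x(1) by auto
    with x show ?thesis by simp
  qed
  \<comment> \<open>The largest \<open>i\<close> below \<open>K\<close> with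
    \<open>i + l < n\<close>. By the bounds on \<open>l\<close> and \<open>K\<close>, both
    \<open>i\<close> and \<open>i - 1\<close> satisfy the conditions of \<open>ends\<close>, so the
    last point would be reached twice.\<close>
  define i where "i = (if l + int K \<le> int n then int K - 1 else int n - 1 - l)"
  have "[r * i = r * (i - 1)] (mod int n)"
    by (rule cong_trans[OF ends cong_sym[OF ends]]) (use K l2 in \<open>auto simp: i_def\<close>)
  then have "[i = i - 1] (mod int n)" using cong_mult_lcancel[OF cop] by blast
  then have "int n dvd 1" by (simp add: cong_iff_dvd_diff)
  then show False using K by auto
qed

text \<open>\<open>V\<close> holds the starting points of runs of length \<open>k\<close>. One run
  leaves a single further residue \<open>y\<close>, which cannot touch that run without forming an
  interval of \<open>k + 1\<close> points. But \<open>y\<close> lies in a run too, so a neighbour of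
  \<open>y\<close> is one residue too many.\<close>

lemma prog_cover_contradiction:
  assumes cop: "coprime r (int n)" and k: "2 < k" "k < n - 2"
    and r: "\<not> [r = 1] (mod int n)" "\<not> [r = - 1] (mod int n)"
    and V: "V \<noteq> {}" "\<And>v w. v \<in> V \<Longrightarrow> [v = w] (mod int n) \<Longrightarrow> w \<in> V"
    and sub: "\<And>v i. v \<in> V \<Longrightarrow> i < k \<Longrightarrow> v + int i \<in> prog n r (k + 1)"
    and cov: "\<And>y. y \<in> prog n r (k + 1) \<Longrightarrow> \<exists>v\<in>V. \<exists>i<k. [y = v + int i] (mod int n)"
  shows False
proof -
  let ?P = "prog n r (k + 1)"
  have noint: "\<not> {w..<w + int (k + 1)} \<subseteq> ?P" for w
    by (rule prog_not_interval[OF cop _ _ r]) (use k in auto)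
  obtain u where u: "u \<in> V" using V by blast
  have subV: "{v..<v + int k} \<subseteq> ?P" if "v \<in> V" for v
  proof
    fix x assume "x \<in> {v..<v + int k}"
    then show "x \<in> ?P" using sub[OF that, of "nat (x - v)"] by auto
  qed
  \<comment> \<open>As \<open>r\<close> is invertible, the \<open>k + 1\<close> terms are distinct
    modulo \<open>n\<close> and cannot all fit into the \<open>k\<close> residues of the run at
    \<open>u\<close>.\<close>
  have "\<exists>y. y \<in> ?P \<and> u + int k \<le> y \<and> y < u + int n"
  proof (rule ccontr)
    assume no: "\<not> ?thesis"
    have "inj_on (\<lambda>i. (r * int i) mod int n) {..<k+1}"
    proof (rule inj_onI)
      fix i j assume ij: "i \<in> {..<k+1}" "j \<in> {..<k+1}" "r * int i mod int n = r * int j mod int n"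
      then have "[int i = int j] (mod int n)"
        using cong_mult_lcancel[OF cop] by (auto simp: cong_def)
      then show "i = j" using ij k cong_less_imp_eq_nat[of i n j] by (auto simp: cong_int_iff)
    qed
    then have "k + 1 = card ((\<lambda>i. (r * int i) mod int n) ` {..<k+1})"
      by (simp add: card_image)
    also have "\<dots> \<le> card ((\<lambda>x. x mod int n) ` {u..<u + int k})"
    proof (intro card_mono subsetI)
      fix z assume "z \<in> (\<lambda>i. (r * int i) mod int n) ` {..<k+1}"
      then obtain i where i: "i < k + 1" "z = (r * int i) mod int n" by auto
      define y where "y = u + (r * int i - u) mod int n"
      have yc: "[r * int i = y] (mod int n)"
        unfolding y_def cong_def by (simp add: mod_simps)
      have "y \<in> ?P"
        unfolding prog_def using i yc cong_sym by blast
      moreover have "u \<le> y" "y < u + int n" using k by (auto simp: y_def)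
      ultimately have "y \<in> {u..<u + int k}" using no not_le by auto
      moreover have "z = y mod int n" using yc i by (simp add: cong_def)
      ultimately show "z \<in> (\<lambda>x. x mod int n) ` {u..<u + int k}" by blast
    qed simp
    also have "\<dots> \<le> k" using card_image_le[of "{u..<u + int k}" "\<lambda>x. x mod int n"] by simp
    finally show False by simp
  qed
  then obtain y where y: "y \<in> ?P" "u + int k \<le> y" "y < u + int n" by blast
  have "y \<noteq> u + int k"
  proof
    assume "y = u + int k"
    then have "{u..<u + int (k + 1)} \<subseteq> insert y {u..<u + int k}" by auto
    then show False using noint[of u] subV[OF u] y(1) by blast
  qed
  moreover have "y \<noteq> u + int n - 1"
  proof
    assume "y = u + int n - 1"
    then have "u - 1 \<in> ?P" using y(1) by (auto intro: prog_cong simp: cong_iff_dvd_diff)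
    moreover have "{u - 1..<u - 1 + int (k + 1)} \<subseteq> insert (u - 1) {u..<u + int k}" by auto
    ultimately show False using noint[of "u - 1"] subV[OF u] by blast
  qed
  ultimately have yb: "u + int k < y" "y < u + int n - 1" using y by auto
  obtain v i where v: "v \<in> V" "i < k" "[y = v + int i] (mod int n)" using cov[OF y(1)] by blast
  have "[v = y - int i] (mod int n)" using v(3) by (metis add_diff_cancel_right' cong_diff cong_refl cong_sym)
  then have vV: "y - int i \<in> V" using V(2)[OF v(1)] by blast
  \<comment> \<open>\<open>i\<close> is the place of \<open>y\<close> in its run. By
    \<open>yb\<close>, both neighbours of \<open>y\<close> avoid the run at \<open>u\<close> and
    stay in the same period.\<close>
  obtain z where z: "z \<in> ?P" "z = y + 1 \<or> z = y - 1"
  proof (cases "i = 0")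
    case True
    then show ?thesis using that[of "y + 1"] sub[OF vV, of 1] k by auto
  next
    case False
    then show ?thesis using that[of "y - 1"] sub[OF vV, of "i - 1"] v(2) by auto
  qed
  have "card (insert z (insert y {u..<u + int k})) \<le> k + 1"
    by (rule prog_card_window[of _ n r _ u]) (use z y yb subV[OF u] k in auto)
  moreover have "card (insert z (insert y {u..<u + int k})) = k + 2"
    using z yb by (subst card_insert_disjoint; auto)
  ultimately show False by simp
qed

text \<open>The interior of each translate lies in the progression; an end does so unless another
  translate can cancel it. If neither \<open>v - k\<close> nor \<open>v + k\<close> were in
  \<open>V\<close>, an interval of \<open>k + 1\<close> points would result. So some
  \<open>u\<close> and \<open>u + k\<close> are in \<open>V\<close>, and their interiors together
  are too large.\<close>

lemma prog_twisted_contradiction: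
  assumes cop: "coprime r (int n)" and k: "2 < k" "k < n - 2"
    and r: "\<not> [r = 1] (mod int n)" "\<not> [r = - 1] (mod int n)"
    and V: "V \<noteq> {}"
    and sub: "\<And>v i. v \<in> V \<Longrightarrow> 0 < i \<Longrightarrow> i < k \<Longrightarrow> v + int i \<in> prog n r (k + 1)"
    and lower: "\<And>v. v \<in> V \<Longrightarrow> v - int k \<notin> V \<Longrightarrow> v \<in> prog n r (k + 1)"
    and upper: "\<And>v. v \<in> V \<Longrightarrow> v + int k \<notin> V \<Longrightarrow> v + int k \<in> prog n r (k + 1)"
  shows False
proof -
  let ?P = "prog n r (k + 1)"
  have noint: "\<not> {w..<w + int (k + 1)} \<subseteq> ?P" for w
    by (rule prog_not_interval[OF cop _ _ r]) (use k in auto)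
  have subV: "{v + 1..<v + int k} \<subseteq> ?P" if "v \<in> V" for v
  proof
    fix x assume "x \<in> {v + 1..<v + int k}"
    then show "x \<in> ?P" using sub[OF that, of "nat (x - v)"] by auto
  qed
  obtain u where u: "u \<in> V" "u + int k \<in> V"
  proof -
    obtain v where v: "v \<in> V" using V by blast
    have "{v..<v + int (k + 1)} \<subseteq> insert v (insert (v + int k) {v + 1..<v + int k})" by auto
    then have "v - int k \<in> V \<or> v + int k \<in> V"
      using lower[OF v] upper[OF v] subV[OF v] noint[of v] by blast
    then show ?thesis using that[of v] that[of "v - int k"] v by auto
  qed
  show False
  proof (cases "k = 3")
    case False
    \<comment> \<open>For \<open>k \<ge> 4\<close> three points of the second interior suffice, and
      \<open>k + 3 \<le> n\<close> keeps them in one period with the first.\<close>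
    let ?X = "{u + 1..<u + int k} \<union> {u + int k + 1..u + int k + 3}"
    have "card ?X \<le> k + 1"
      using subV[OF u(1)] subV[OF u(2)] False k
      by (intro prog_card_window[of _ n r _ "u + 1"]) auto
    moreover have "card ?X = k + 2"
      using k by (subst card_Un_disjoint) auto
    ultimately show False by simp
  next
    case True
    \<comment> \<open>The only units modulo 6 are 1 and -1. The counts below need a period of at
      least 7.\<close>
    have "n \<noteq> 6"
    proof
      assume n: "n = 6"
      have "r mod 6 \<noteq> 1" "r mod 6 \<noteq> 5" using r n by (auto simp: cong_def)
      then have "2 dvd r \<or> 3 dvd r" by presburger
      moreover have "\<not> 2 dvd r" "\<not> 3 dvd r"
        using cop n coprime_common_divisor[of r 6 2] coprime_common_divisor[of r 6 3] by auto
      ultimately show False by blast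
    qed
    then have n: "n \<ge> 7" using k True by simp
    have P: "{u + 1, u + 2, u + 4, u + 5} \<subseteq> ?P"
      using sub[OF u(1), of 1] sub[OF u(1), of 2] sub[OF u(2), of 1] sub[OF u(2), of 2] True
      by (auto simp: add.assoc)
    \<comment> \<open>The interior at \<open>u - 3\<close> would add \<open>u - 1\<close>: five
      residues among seven consecutive integers, against \<open>k + 1 = 4\<close>.\<close>
    have "u - 3 \<notin> V"
    proof
      assume "u - 3 \<in> V"
      from sub[OF this, of 2] have "{u - 1, u + 1, u + 2, u + 4, u + 5} \<subseteq> ?P"
        using P True by auto
      from prog_card_window[OF this, of "u - 1"] show False using n True by auto
    qed
    then have "u \<in> ?P" using lower[OF u(1)] True by simp
    with P have "{u, u + 1, u + 2, u + 4, u + 5} \<subseteq> ?P" by blast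
    from prog_card_window[OF this, of u] show False using n True by auto
  qed
qed

section \<open>Exponents and coefficients of composed maps\<close>

definition H_coeff :: "nat \<Rightarrow> nat \<Rightarrow> 'a::field \<Rightarrow> nat \<Rightarrow> (nat \<Rightarrow> 'a) \<Rightarrow> nat \<Rightarrow> 'a" where
  "H_coeff q k \<eta> h a i = (if i < k then a i else \<eta> * a 0 ^ (q ^ h))"

text \<open>Working with functions lets the exponents \<open>q ^ (s * i)\<close> stay
  unreduced.\<close>

definition q_map :: "nat \<Rightarrow> nat set \<Rightarrow> nat \<Rightarrow> (nat \<Rightarrow> 'a::field) \<Rightarrow> 'a \<Rightarrow> 'a" where
  "q_map q E s w x = (\<Sum>i\<in>E. w i * x ^ (q ^ (s * i)))"

text \<open>The sum of the supports of the outer and inner map, divided by \<open>s\<close> modulo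
  \<open>n\<close>: a middle term \<open>x ^ (q ^ (s * i))\<close> is sent to exponents indexed by
  \<open>s * (v + i)\<close> with \<open>v\<close> a shift.\<close>

definition shifts :: "nat \<Rightarrow> nat \<Rightarrow> (nat \<Rightarrow> 'a::zero) \<Rightarrow> (nat \<Rightarrow> 'a) \<Rightarrow> int set" where
  "shifts n s c d = {v. \<exists>j<n. \<exists>m<n. c j \<noteq> 0 \<and> d m \<noteq> 0 \<and> [int s * v = int (j + m)] (mod int n)}"

lemma shifts_cong: "v \<in> shifts n s c d \<Longrightarrow> [v = w] (mod int n) \<Longrightarrow> w \<in> shifts n s c d"
  unfolding shifts_def by (blast intro: cong_trans cong_sym cong_scalar_left)

lemma shifts_nonempty:
  assumes "coprime n s" "j < n" "c j \<noteq> 0" "m < n" "d m \<noteq> 0"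
  shows "shifts n s c d \<noteq> {}"
proof -
  have "coprime (int s) (int n)" using assms(1) by (simp add: coprime_commute)
  then obtain s' where "[int s * s' = 1] (mod int n)" using cong_solve_coprime_int by blast
  from cong_scalar_right[OF this, of "int (j + m)"]
  have "[int s * (s' * int (j + m)) = int (j + m)] (mod int n)" by (simp add: mult.assoc)
  then show ?thesis unfolding shifts_def using assms by blast
qed

text \<open>The image has, at each position, a coefficient that is a \<open>q\<close>-polynomial in
  the parameter \<open>y\<close>. Outside the target progression it vanishes for all
  \<open>y\<close>, hence identically; but at \<open>v + i0\<close> one of its monomials has nothing
  to cancel with.\<close>

lemma image_position:
  fixes c d \<omega> :: "nat \<Rightarrow> 'a :: {field, finite}"
  assumes q: "primepow q" and card: "CARD('a) = q ^ n" and n: "n > 0"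
    and cop: "coprime n s" and r: "[int s * r = int t] (mod int n)"
    and eq: "\<And>y. \<exists>b. \<forall>x. q_map q {..<n} 1 c (q_map q {..k} s (\<lambda>i. \<omega> i * y ^ (q ^ \<gamma> i))
               (q_map q {..<n} 1 d x)) = q_map q {..<K} t b x"
    and v: "v \<in> shifts n s c d" and i0: "i0 \<le> k" "\<omega> i0 \<noteq> 0"
    and others: "\<And>i. i \<le> k \<Longrightarrow> i \<noteq> i0 \<Longrightarrow> \<omega> i \<noteq> 0 \<Longrightarrow> v + int i0 - int i \<notin> shifts n s c d"
  shows "v + int i0 \<in> prog n r K"
proof (rule ccontr)
  assume notin: "v + int i0 \<notin> prog n r K"
  have q0: "q > 0" using q primepow_gt_Suc_0 by force
  have cop': "coprime (int s) (int n)" using cop by (simp add: coprime_commute)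
  obtain j0 m0 where jm0: "j0 < n" "m0 < n" "c j0 \<noteq> 0" "d m0 \<noteq> 0"
      "[int s * v = int (j0 + m0)] (mod int n)"
    using v unfolding shifts_def by blast
  have pos: "[int s * (v + int i0) = int (m0 + s * i0 + j0)] (mod int n)"
    using cong_add[OF jm0(5) cong_refl[of "int (s * i0)"]] by (simp add: algebra_simps)
  define \<rho> where "\<rho> = (m0 + s * i0 + j0) mod n"
  \<comment> \<open>Each triple in \<open>E\<close> gives one term of the image: \<open>p\<close>
    and \<open>\<pi>\<close> index its exponents in \<open>x\<close> and \<open>y\<close>, and
    \<open>T\<close> is its constant factor.\<close>
  define E where "E = {..k} \<times> {..<n} \<times> {..<n}"
  define p where "p = (\<lambda>(i, j, m). m + s * i + j)"
  define E\<rho> where "E\<rho> = {e \<in> E. p e mod n = \<rho>}"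
  define \<pi> where "\<pi> = (\<lambda>(i, j, m :: nat). \<gamma> i + j)"
  define T where "T = (\<lambda>(i, j, m). c j * \<omega> i ^ (q ^ j) * d m ^ (q ^ (s * i + j)))"
  let ?W = "\<lambda>y (i, j, m). c j * (\<omega> i * y ^ (q ^ \<gamma> i)) ^ (q ^ j) * d m ^ (q ^ (s * i + j))"
  have WT: "?W y e = T e * y ^ (q ^ \<pi> e)" for y e
    by (cases e) (simp add: T_def \<pi>_def power_mult_distrib power_add mult_ac flip: power_mult)
  have fin: "finite E" unfolding E_def by simp
  have vanish: "(\<Sum>e\<in>E\<rho>. T e * y ^ (q ^ \<pi> e)) = 0" for y
  proof (rule ccontr)
    assume nz: "(\<Sum>e\<in>E\<rho>. T e * y ^ (q ^ \<pi> e)) \<noteq> 0"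
    obtain b where b: "\<And>x. q_map q {..<n} 1 c (q_map q {..k} s (\<lambda>i. \<omega> i * y ^ (q ^ \<gamma> i))
               (q_map q {..<n} 1 d x)) = q_map q {..<K} t b x"
      using eq by blast
    have expand: "(\<Sum>e\<in>E. (T e * y ^ (q ^ \<pi> e)) * x ^ (q ^ p e)) = (\<Sum>i<K. b i * x ^ (q ^ (t * i)))" for x
    proof -
      have "(\<Sum>e\<in>E. (T e * y ^ (q ^ \<pi> e)) * x ^ (q ^ p e))
          = (\<Sum>(i, j, m)\<in>E. (c j * (\<omega> i * y ^ (q ^ \<gamma> i)) ^ (q ^ j) * d m ^ (q ^ (s * i + j)))
              * x ^ (q ^ (m + s * i + j)))"
        by (intro sum.cong refl) (auto simp: p_def simp flip: WT)
      also have "\<dots> = q_map q {..<n} 1 c (q_map q {..k} s (\<lambda>i. \<omega> i * y ^ (q ^ \<gamma> i)) (q_map q {..<n} 1 d x))"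
        unfolding E_def q_map_def mult_1 q_polynomial_composition[OF q card] ..
      finally show ?thesis using b[of x] unfolding q_map_def by simp
    qed
    have "(\<Sum>e | e \<in> E \<and> p e mod n = \<rho>. T e * y ^ (q ^ \<pi> e)) \<noteq> 0"
      using nz unfolding E\<rho>_def .
    from q_polynomial_support[OF q card n fin finite_lessThan expand this]
    obtain i where i: "i < K" "t * i mod n = \<rho>" using n unfolding \<rho>_def by auto
    have "[m0 + s * i0 + j0 = t * i] (mod n)"
      using i(2) by (simp add: \<rho>_def cong_def)
    then have "[int s * (v + int i0) = int (t * i)] (mod int n)"
      using pos cong_int_iff cong_trans by blast
    moreover have "[int (t * i) = int s * (r * int i)] (mod int n)"
      using cong_scalar_right[OF cong_sym[OF r], of "int i"] by (simp add: mult.assoc)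
    ultimately have "[int s * (v + int i0) = int s * (r * int i)] (mod int n)"
      by (rule cong_trans)
    then have "[v + int i0 = r * int i] (mod int n)"
      using cong_mult_lcancel[OF cop'] by blast
    then show False using notin i(1) unfolding prog_def by blast
  qed
  let ?e0 = "(i0, j0, m0)"
  \<comment> \<open>The terms at this position with the same exponent in \<open>y\<close> as
    \<open>?e0\<close>. A different \<open>i\<close> is excluded by \<open>others\<close>; for
    \<open>i = i0\<close> the exponent in \<open>y\<close> fixes \<open>j\<close>, and then the one
    in \<open>x\<close> fixes \<open>m\<close>.\<close>
  let ?S = "{e \<in> E\<rho>. \<pi> e mod n = \<pi> ?e0 mod n}"
  have "sum T ?S = sum T {?e0}"
  proof (rule sum.mono_neutral_right)
    show "finite ?S" unfolding E\<rho>_def using fin by simp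
    show "{?e0} \<subseteq> ?S" using jm0 i0 by (simp add: E\<rho>_def E_def p_def \<rho>_def)
    show "\<forall>e\<in>?S - {?e0}. T e = 0"
    proof (rule ballI, rule ccontr)
      fix e assume e: "e \<in> ?S - {?e0}" and Te: "T e \<noteq> 0"
      obtain i j m where ijm: "e = (i, j, m)" by (cases e)
      have b: "i \<le> k" "j < n" "m < n" "(m + s * i + j) mod n = \<rho>"
          "(\<gamma> i + j) mod n = (\<gamma> i0 + j0) mod n"
        using e unfolding ijm by (auto simp: E\<rho>_def E_def p_def \<pi>_def)
      have nz: "c j \<noteq> 0" "\<omega> i \<noteq> 0" "d m \<noteq> 0"
        using Te q0 unfolding ijm T_def by auto
      have posi: "[int (m + s * i + j) = int (m0 + s * i0 + j0)] (mod int n)"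
        using b(4) unfolding \<rho>_def cong_int_iff by (simp only: cong_def)
      have "i = i0"
      proof (rule ccontr)
        assume ne: "i \<noteq> i0"
        have "[int s * (v + int i0) = int (m + s * i + j)] (mod int n)"
          using pos posi cong_sym cong_trans by blast
        from cong_diff[OF this cong_refl[of "int (s * i)"]]
        have "[int s * (v + int i0 - int i) = int (j + m)] (mod int n)"
          by (simp add: algebra_simps)
        then have "v + int i0 - int i \<in> shifts n s c d"
          unfolding shifts_def using b nz by blast
        then show False using others[OF b(1) ne nz(2)] by blast
      qed
      have "[\<gamma> i0 + j = \<gamma> i0 + j0] (mod n)" using b(5) \<open>i = i0\<close> by (simp add: cong_def)
      then have "j = j0"
        using b(2) jm0(1) cong_add_lcancel_nat cong_less_modulus_unique_nat by blast
      have "[(s * i0 + j0) + m = (s * i0 + j0) + m0] (mod n)"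
        using b(4) \<open>i = i0\<close> \<open>j = j0\<close> by (simp add: \<rho>_def cong_def ac_simps)
      then have "m = m0"
        using b(3) jm0(2) cong_add_lcancel_nat cong_less_modulus_unique_nat by blast
      then show False using e ijm \<open>i = i0\<close> \<open>j = j0\<close> by blast
    qed
  qed
  also have "\<dots> \<noteq> 0" using jm0 i0 by (simp add: T_def)
  finally have nz: "sum T {e \<in> E\<rho>. \<pi> e mod n = \<pi> ?e0 mod n} \<noteq> 0" .
  have "finite E\<rho>" unfolding E\<rho>_def using fin by simp
  \<comment> \<open>Second comparison of coefficients, now in \<open>y\<close> and against the empty
    sum.\<close>
  from q_polynomial_support[OF q card n this finite.emptyI _ nz, of "\<lambda>_ :: unit. 0" "\<lambda>_. 0"]
  show False using vanish n by simp
qed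

text \<open>Comparison in the other direction: a nonzero target coefficient must come from some term
  of the expanded composite.\<close>

lemma image_covered:
  fixes c d \<omega> b :: "nat \<Rightarrow> 'a :: {field, finite}"
  assumes q: "primepow q" and card: "CARD('a) = q ^ n" and n: "n > 0"
    and cop: "coprime n t" and r: "[int s * r = int t] (mod int n)"
    and eq: "\<And>x. q_map q {..<n} 1 c (q_map q {..k} s \<omega> (q_map q {..<n} 1 d x)) = q_map q {..<K} t b x"
    and K: "K \<le> n" and b: "\<And>i. i < K \<Longrightarrow> b i \<noteq> 0" and y: "y \<in> prog n r K"
  shows "\<exists>v\<in>shifts n s c d. \<exists>i\<le>k. \<omega> i \<noteq> 0 \<and> [y = v + int i] (mod int n)"
proof -
  have q0: "q > 0" using q primepow_gt_Suc_0 by force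
  obtain i0 where i0: "i0 < K" "[y = r * int i0] (mod int n)" using y unfolding prog_def by blast
  \<comment> \<open>The exponents \<open>t * i\<close> are distinct modulo \<open>n\<close>, so the
    reduced coefficient is \<open>b i0\<close> alone.\<close>
  have "{i \<in> {..<K}. t * i mod n = t * i0 mod n} = {i0}"
  proof (intro equalityI subsetI)
    fix i assume "i \<in> {i \<in> {..<K}. t * i mod n = t * i0 mod n}"
    then have "i < K" "[t * i = t * i0] (mod n)" by (auto simp: cong_def)
    then have "[i = i0] (mod n)"
      using cong_mult_lcancel_nat[of t n] cop by (simp add: coprime_commute)
    then show "i \<in> {i0}"
      using \<open>i < K\<close> i0(1) K cong_less_modulus_unique_nat by fastforce
  qed (use i0 in auto)
  then have nz: "(\<Sum>i | i \<in> {..<K} \<and> t * i mod n = t * i0 mod n. b i) \<noteq> 0"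
    using b[OF i0(1)] by simp
  define p where "p = (\<lambda>(i, j, m). m + s * i + j)"
  define T where "T = (\<lambda>(i, j, m). c j * \<omega> i ^ (q ^ j) * d m ^ (q ^ (s * i + j)))"
  have expand: "(\<Sum>i<K. b i * x ^ (q ^ (t * i))) = (\<Sum>e\<in>{..k} \<times> {..<n} \<times> {..<n}. T e * x ^ (q ^ p e))" for x
  proof -
    have "(\<Sum>i<K. b i * x ^ (q ^ (t * i))) = q_map q {..<n} 1 c (q_map q {..k} s \<omega> (q_map q {..<n} 1 d x))"
      using eq[of x] by (simp add: q_map_def)
    also have "\<dots> = (\<Sum>e\<in>{..k} \<times> {..<n} \<times> {..<n}. T e * x ^ (q ^ p e))"
      unfolding q_map_def mult_1 q_polynomial_composition[OF q card]
      by (intro sum.cong refl) (auto simp: p_def T_def)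
    finally show ?thesis .
  qed
  have fin: "finite ({..k} \<times> {..<n} \<times> {..<n})" by simp
  obtain e where e: "e \<in> {..k} \<times> {..<n} \<times> {..<n}" "T e \<noteq> 0" "p e mod n = t * i0 mod n"
    using q_polynomial_support[OF q card n finite_lessThan fin expand nz] n by auto
  obtain i j m where ijm: "e = (i, j, m)" by (cases e)
  have nz: "c j \<noteq> 0" "\<omega> i \<noteq> 0" "d m \<noteq> 0"
    using e(2) q0 unfolding ijm T_def by auto
  have bd: "i \<le> k" "j < n" "m < n" using e(1) ijm by auto
  have "[int s * (r * int i0) = int (t * i0)] (mod int n)"
    using cong_scalar_right[OF r, of "int i0"] by (simp add: mult.assoc)
  moreover have "[t * i0 = m + s * i + j] (mod n)"
    using e(3) by (simp add: ijm p_def cong_def)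
  then have "[int (t * i0) = int (m + s * i + j)] (mod int n)"
    by (simp only: cong_int_iff)
  moreover have "[int s * y = int s * (r * int i0)] (mod int n)"
    using i0(2) by (rule cong_scalar_left)
  ultimately have "[int s * y = int (m + s * i + j)] (mod int n)" using cong_trans by blast
  from cong_diff[OF this cong_refl[of "int (s * i)"]]
  have "[int s * (y - int i) = int (j + m)] (mod int n)" by (simp add: algebra_simps)
  then have "y - int i \<in> shifts n s c d" unfolding shifts_def using bd nz by blast
  then show ?thesis using bd nz by (intro bexI[of _ "y - int i"] exI[of _ i]) auto
qed

section \<open>From equivalence of codes to identities of functions\<close>

lemma poly_mod_field_poly:
  fixes x :: "'a :: {field, finite}"
  assumes "CARD('a) = q ^ n"
  shows "poly (p mod field_poly q n) x = poly p x"
  by (rule poly_mod) (simp add: field_poly_def poly_monom power_CARD_eq_self flip: assms)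

lemma poly_H_code:
  fixes a :: "nat \<Rightarrow> 'a :: {field, finite}"
  assumes "CARD('a) = q ^ n"
  shows "poly (((\<Sum>i<k. monom (a i) (q ^ (s * i))) + monom (\<eta> * a 0 ^ (q ^ h)) (q ^ (s * k)))
        mod field_poly q n) x = q_map q {..k} s (H_coeff q k \<eta> h a) x"
  by (simp add: poly_mod_field_poly[OF assms] poly_sum poly_monom q_map_def H_coeff_def
      flip: lessThan_Suc_atMost)

text \<open>The zero map identifies 0 and 1, so a bijection has a nonzero coefficient.\<close>

lemma perm_q_polyE:
  fixes L :: "'a :: {field, finite} poly"
  assumes "L \<in> perm_q_polys q n"
  obtains c j where "j < n" "c j \<noteq> 0" "poly L = q_map q {..<n} 1 c"
proof -
  obtain c where c: "L = (\<Sum>i<n. monom (c i) (q ^ i))" and bij: "bij (poly L)"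
    using assms by (auto simp: perm_q_polys_def q_polys_def)
  have L: "poly L = q_map q {..<n} 1 c"
    unfolding c by (auto simp: poly_sum poly_monom q_map_def)
  have "\<exists>j<n. c j \<noteq> 0"
  proof (rule ccontr)
    assume "\<not> ?thesis"
    then have "poly L 0 = poly L 1" unfolding L by (simp add: q_map_def)
    then show False using bij by (auto simp: bij_def dest: injD)
  qed
  then show ?thesis using L that by blast
qed

context
  fixes \<sigma> :: "'a :: field \<Rightarrow> 'a"
  assumes \<sigma>: "field_automorphism_on UNIV \<sigma>"
begin

lemma automorphism_simps [simp]:
  "\<sigma> (x + y) = \<sigma> x + \<sigma> y" "\<sigma> (x * y) = \<sigma> x * \<sigma> y" "\<sigma> 0 = 0" "\<sigma> 1 = 1" "bij \<sigma>" "\<sigma> x = 0 \<longleftrightarrow> x = 0"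
proof -
  show add: "\<sigma> (x + y) = \<sigma> x + \<sigma> y" and mult: "\<sigma> (x * y) = \<sigma> x * \<sigma> y" and bij: "bij \<sigma>" for x y
    using \<sigma> by (auto simp: field_automorphism_on_def)
  show 0: "\<sigma> 0 = 0" using add[of 0 0] by (metis add_0_right add_left_cancel)
  show iff: "\<sigma> x = 0 \<longleftrightarrow> x = 0" for x using bij 0 by (metis bij_def injD)
  show "\<sigma> 1 = 1" using mult[of 1 1] iff[of 1] by simp
qed

lemma automorphism_power: "\<sigma> (x ^ e) = \<sigma> x ^ e"
  by (induction e) simp_all

lemma automorphism_sum: "\<sigma> (\<Sum>i\<in>E. f i) = (\<Sum>i\<in>E. \<sigma> (f i))"
  by (induction E rule: infinite_finite_induct) simp_all

lemma poly_map_automorphism: "poly (map_poly \<sigma> p) (\<sigma> x) = \<sigma> (poly p x)"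
  by (induction p) (simp_all add: map_poly_pCons)

lemma automorphism_q_map: "\<sigma> (q_map q E s w x) = q_map q E s (\<sigma> \<circ> w) (\<sigma> x)"
  by (simp add: q_map_def automorphism_sum automorphism_power)

lemma automorphism_H_coeff: "\<sigma> \<circ> H_coeff q k \<eta> h a = H_coeff q k (\<sigma> \<eta>) h (\<sigma> \<circ> a)"
  by (auto simp: H_coeff_def automorphism_power)

text \<open>Both sides are the conjugate of \<open>poly f\<close> by
  \<open>\<sigma>\<close>.\<close>

lemma poly_map_automorphism_q_map:
  assumes "poly f = q_map q E s w"
  shows "poly (map_poly \<sigma> f) = q_map q E s (\<sigma> \<circ> w)"
proof
  fix x
  have "x = \<sigma> (inv \<sigma> x)" by (simp add: bij_is_surj surj_f_inv_f)
  then show "poly (map_poly \<sigma> f) x = q_map q E s (\<sigma> \<circ> w) x"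
    using poly_map_automorphism[of f "inv \<sigma> x"] automorphism_q_map assms by metis
qed

end

text \<open>The automorphism only turns \<open>\<eta>\<close> into \<open>\<eta>'\<close> and
  \<open>a\<close> into \<open>\<sigma> \<circ> a\<close>, and by surjectivity the latter is again
  arbitrary. The last two facts are the two inclusions between the codes.\<close>

lemma code_equivE:
  fixes \<eta> \<theta> :: "'a :: {field, finite}"
  assumes card: "CARD('a) = q ^ n"
    and equiv: "code_equiv q n (H_code q n k s \<eta> g) (H_code q n k t \<theta> h)"
  obtains c d \<eta>' j m where "j < n" "c j \<noteq> 0" "m < n" "d m \<noteq> 0" "\<eta>' = 0 \<longleftrightarrow> \<eta> = 0"
    "\<And>a. \<exists>b. \<forall>x. q_map q {..<n} 1 c (q_map q {..k} s (H_coeff q k \<eta>' g a) (q_map q {..<n} 1 d x))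
       = q_map q {..k} t (H_coeff q k \<theta> h b) x"
    "\<And>b. \<exists>a. \<forall>x. q_map q {..<n} 1 c (q_map q {..k} s (H_coeff q k \<eta>' g a) (q_map q {..<n} 1 d x))
       = q_map q {..k} t (H_coeff q k \<theta> h b) x"
proof -
  obtain L1 L2 \<sigma> where L: "L1 \<in> perm_q_polys q n" "L2 \<in> perm_q_polys q n"
    and \<sigma>: "field_automorphism_on UNIV \<sigma>"
    and C: "H_code q n k t \<theta> h
      = {pcompose L1 (pcompose (map_poly \<sigma> f) L2) mod field_poly q n | f. f \<in> H_code q n k s \<eta> g}"
    using equiv unfolding code_equiv_def by blast
  obtain c j where c: "j < n" "c j \<noteq> 0" "poly L1 = q_map q {..<n} 1 c"
    using L(1) by (rule perm_q_polyE)
  obtain d m where d: "m < n" "d m \<noteq> 0" "poly L2 = q_map q {..<n} 1 d"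
    using L(2) by (rule perm_q_polyE)
  let ?P = "\<lambda>s \<eta> h a. ((\<Sum>i<k. monom (a i) (q ^ (s * i))) + monom (\<eta> * a 0 ^ (q ^ h)) (q ^ (s * k)))
        mod field_poly q n"
  let ?I = "\<lambda>f. pcompose L1 (pcompose (map_poly \<sigma> f) L2) mod field_poly q n"
  have val: "poly (?I (?P s \<eta> g a)) x
      = q_map q {..<n} 1 c (q_map q {..k} s (H_coeff q k (\<sigma> \<eta>) g (\<sigma> \<circ> a)) (q_map q {..<n} 1 d x))" for a x
    unfolding poly_mod_field_poly[OF card] poly_pcompose c(3) d(3)
    by (subst poly_map_automorphism_q_map[OF \<sigma>, OF ext[OF poly_H_code[OF card]]])
       (simp add: automorphism_H_coeff[OF \<sigma>])
  show ?thesis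
  proof (rule that[where c = c and d = d and \<eta>' = "\<sigma> \<eta>", OF c(1,2) d(1,2)])
    show "\<sigma> \<eta> = 0 \<longleftrightarrow> \<eta> = 0" using \<sigma> by simp
  next
    fix a :: "nat \<Rightarrow> 'a"
    have "surj \<sigma>" using automorphism_simps(5)[OF \<sigma>] by (simp add: bij_is_surj)
    then have a: "\<sigma> \<circ> (inv \<sigma> \<circ> a) = a" by (auto simp: surj_f_inv_f)
    have "?I (?P s \<eta> g (inv \<sigma> \<circ> a)) \<in> H_code q n k t \<theta> h"
      unfolding C by (auto simp: H_code_def)
    then obtain b where b: "?I (?P s \<eta> g (inv \<sigma> \<circ> a)) = ?P t \<theta> h b"
      unfolding H_code_def by blast
    show "\<exists>b. \<forall>x. q_map q {..<n} 1 c (q_map q {..k} s (H_coeff q k (\<sigma> \<eta>) g a) (q_map q {..<n} 1 d x))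
       = q_map q {..k} t (H_coeff q k \<theta> h b) x"
      using val[of "inv \<sigma> \<circ> a"] unfolding a b poly_H_code[OF card] by metis
  next
    fix b :: "nat \<Rightarrow> 'a"
    have "?P t \<theta> h b \<in> H_code q n k t \<theta> h" by (auto simp: H_code_def)
    then obtain a where a: "?P t \<theta> h b = ?I (?P s \<eta> g a)"
      unfolding C unfolding H_code_def by blast
    show "\<exists>a. \<forall>x. q_map q {..<n} 1 c (q_map q {..k} s (H_coeff q k (\<sigma> \<eta>) g a) (q_map q {..<n} 1 d x))
       = q_map q {..k} t (H_coeff q k \<theta> h b) x"
      using val[of a] unfolding a[symmetric] poly_H_code[OF card] by metis
  qed
qed

section \<open>Positions forced by an equivalence, and the three cases\<close>

text \<open>\<open>r\<close> is the quotient \<open>t / s\<close> modulo \<open>n\<close>, the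
  difference of the target progression after rescaling by \<open>1 / s\<close>.\<close>

lemma ratio_not_unit:
  assumes cop: "coprime n s" "coprime n t"
    and ne: "\<not> [int s = int t] (mod int n)" "\<not> [int s = - int t] (mod int n)"
  obtains r where "[int s * r = int t] (mod int n)" "coprime r (int n)"
    "\<not> [r = 1] (mod int n)" "\<not> [r = - 1] (mod int n)"
proof -
  have coprime_s: "coprime (int s) (int n)" using cop by (simp add: coprime_commute)
  have coprime_t: "coprime (int t) (int n)" using cop by (simp add: coprime_commute)
  obtain s' where s': "[int s * s' = 1] (mod int n)" using cong_solve_coprime_int[OF coprime_s] by blast
  define r where "r = s' * int t"
  have r: "[int s * r = int t] (mod int n)"
    using cong_scalar_right[OF s', of "int t"] by (simp add: r_def mult.assoc)
  have "coprime (int s * r) (int n)"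
    using coprime_t cong_sym[OF r] by (metis cong_imp_coprime)
  then have "coprime r (int n)" by simp
  moreover have "\<not> [r = 1] (mod int n)"
  proof
    assume "[r = 1] (mod int n)"
    from cong_scalar_left[OF this, of "int s"] have "[int s * r = int s] (mod int n)" by simp
    then show False using r ne(1) cong_sym cong_trans by blast
  qed
  moreover have "\<not> [r = - 1] (mod int n)"
  proof
    assume "[r = - 1] (mod int n)"
    from cong_scalar_left[OF this, of "int s"] have "[int s * r = - int s] (mod int n)" by simp
    then have "[- int s = int t] (mod int n)" using r cong_sym cong_trans by blast
    then have "[int s = - int t] (mod int n)" using cong_minus_minus_iff by fastforce
    then show False using ne(2) by blast
  qed
  ultimately show ?thesis using r that by blast
qed

text \<open>Such a coefficient enters a single term, so setting all others to zero leaves a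
  monomial, with no other term to cancel against.\<close>

lemma H_image_free_position:
  fixes c d :: "nat \<Rightarrow> 'a :: {field, finite}"
  assumes q: "primepow q" and card: "CARD('a) = q ^ n" and n: "n > 0"
    and cop: "coprime n s" and r: "[int s * r = int t] (mod int n)"
    and eq: "\<And>a. \<exists>b. \<forall>x. q_map q {..<n} 1 c (q_map q {..k} s (H_coeff q k \<eta> g a)
               (q_map q {..<n} 1 d x)) = q_map q {..<K} t b x"
    and v: "v \<in> shifts n s c d" and i: "i < k" "0 < i \<or> \<eta> = 0"
  shows "v + int i \<in> prog n r K"
proof (rule image_position[OF q card n cop r, where \<omega> = "\<lambda>i'. if i' = i then 1 else 0" and \<gamma> = "\<lambda>_. 0" and k = k])
  fix y :: 'a
  \<comment> \<open>Makes \<open>0 ^ (q ^ g)\<close> zero, so the twisted term disappears when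
    \<open>a 0\<close> is zero.\<close>
  have "q > 0" using q primepow_gt_Suc_0 by force
  then have "H_coeff q k \<eta> g (\<lambda>i'. if i' = i then y else 0)
      = (\<lambda>i'. (if i' = i then 1 else 0) * y ^ (q ^ 0))"
    using i by (auto simp: H_coeff_def)
  then show "\<exists>b. \<forall>x. q_map q {..<n} 1 c (q_map q {..k} s (\<lambda>i'. (if i' = i then 1 else 0) * y ^ (q ^ 0))
           (q_map q {..<n} 1 d x)) = q_map q {..<K} t b x"
    using eq[of "\<lambda>i'. if i' = i then y else 0"] by (simp only:)
qed (use v i in auto)

text \<open>\<open>a 0\<close> governs the terms at \<open>0\<close> and \<open>k\<close> together,
  so each can be cancelled only by the other, through a shift differing by \<open>k\<close>.\<close>

lemma H_image_end_position:
  fixes c d :: "nat \<Rightarrow> 'a :: {field, finite}"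
  assumes q: "primepow q" and card: "CARD('a) = q ^ n" and n: "n > 0"
    and cop: "coprime n s" and r: "[int s * r = int t] (mod int n)"
    and eq: "\<And>a. \<exists>b. \<forall>x. q_map q {..<n} 1 c (q_map q {..k} s (H_coeff q k \<eta> g a)
               (q_map q {..<n} 1 d x)) = q_map q {..<K} t b x"
    and v: "v \<in> shifts n s c d" and k: "k > 0"
  shows "v - int k \<notin> shifts n s c d \<Longrightarrow> v \<in> prog n r K"
    and "\<eta> \<noteq> 0 \<Longrightarrow> v + int k \<notin> shifts n s c d \<Longrightarrow> v + int k \<in> prog n r K"
proof -
  let ?\<omega> = "\<lambda>i. if i = 0 then 1 else if i = k then \<eta> else 0"
  let ?\<gamma> = "\<lambda>i. if i = k then g else 0"
  have twisted: "\<exists>b. \<forall>x. q_map q {..<n} 1 c (q_map q {..k} s (\<lambda>i. ?\<omega> i * y ^ (q ^ ?\<gamma> i))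
         (q_map q {..<n} 1 d x)) = q_map q {..<K} t b x" for y
  proof -
    have "q_map q {..k} s (H_coeff q k \<eta> g (\<lambda>i. if i = 0 then y else 0)) x
      = q_map q {..k} s (\<lambda>i. ?\<omega> i * y ^ (q ^ ?\<gamma> i)) x" for x
      unfolding q_map_def by (intro sum.cong) (use k in \<open>auto simp: H_coeff_def\<close>)
    then show ?thesis using eq[of "\<lambda>i. if i = 0 then y else 0"] by simp
  qed
  note position = image_position[OF q card n cop r twisted v]
  have "v + int 0 \<in> prog n r K" if "v - int k \<notin> shifts n s c d"
    by (rule position) (use that in \<open>auto split: if_splits\<close>)
  then show "v \<in> prog n r K" if "v - int k \<notin> shifts n s c d"
    using that by simp
  show "v + int k \<in> prog n r K" if "\<eta> \<noteq> 0" "v + int k \<notin> shifts n s c d"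
    by (rule position) (use that in \<open>auto split: if_splits\<close>)
qed

lemma q_map_H_coeff_truncate:
  "q_map q {..k} t (H_coeff q k \<theta> h b) x
    = q_map q {..<if \<theta> = 0 then k else k + 1} t (H_coeff q k \<theta> h b) x"
  by (auto simp: q_map_def H_coeff_def simp flip: lessThan_Suc_atMost)

lemma H_image_untwisted_contradiction:
  fixes c d :: "nat \<Rightarrow> 'a :: {field, finite}"
  assumes q: "primepow q" and card: "CARD('a) = q ^ n"
    and cop: "coprime n s" and r: "[int s * r = int t] (mod int n)"
    and unit: "coprime r (int n)" "\<not> [r = 1] (mod int n)" "\<not> [r = - 1] (mod int n)"
    and V: "shifts n s c d \<noteq> {}" and k: "1 < k" "k < n - 1"
    and eq: "\<And>a. \<exists>b. \<forall>x. q_map q {..<n} 1 c (q_map q {..k} s (H_coeff q k 0 g a)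
               (q_map q {..<n} 1 d x)) = q_map q {..<k} t b x"
  shows False
proof -
  obtain v where v: "v \<in> shifts n s c d" using V by blast
  have "n > 0" using k by simp
  have "{v..<v + int k} \<subseteq> prog n r k"
  proof
    fix x assume "x \<in> {v..<v + int k}"
    then show "x \<in> prog n r k"
      using H_image_free_position[OF q card \<open>n > 0\<close> cop r eq v, of "nat (x - v)"] by auto
  qed
  moreover have "\<not> {v..<v + int k} \<subseteq> prog n r k"
    by (rule prog_not_interval) (use unit k in auto)
  ultimately show False by blast
qed

text \<open>\<open>full\<close> describes a source element whose image has no zero coefficient, so
  the whole progression is covered by intervals of length \<open>k\<close> starting at
  shifts.\<close>

lemma H_image_mixed_contradiction:
  fixes c d :: "nat \<Rightarrow> 'a :: {field, finite}"
  assumes q: "primepow q" and card: "CARD('a) = q ^ n"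
    and cop: "coprime n s" "coprime n t" and r: "[int s * r = int t] (mod int n)"
    and unit: "coprime r (int n)" "\<not> [r = 1] (mod int n)" "\<not> [r = - 1] (mod int n)"
    and V: "shifts n s c d \<noteq> {}" and k: "2 < k" "k < n - 2"
    and eq: "\<And>a. \<exists>b. \<forall>x. q_map q {..<n} 1 c (q_map q {..k} s (H_coeff q k 0 g a)
               (q_map q {..<n} 1 d x)) = q_map q {..<k + 1} t b x"
    and full: "\<And>x. q_map q {..<n} 1 c (q_map q {..k} s (H_coeff q k 0 g a)
               (q_map q {..<n} 1 d x)) = q_map q {..<k + 1} t b x"
    and b: "\<And>i. i < k + 1 \<Longrightarrow> b i \<noteq> 0"
  shows False
proof -
  have n: "n > 0" "k + 1 \<le> n" using k by auto
  have cover: "\<exists>v\<in>shifts n s c d. \<exists>i<k. [y = v + int i] (mod int n)" if y: "y \<in> prog n r (k + 1)" for y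
    using image_covered[OF q card n(1) cop(2) r full n(2) b y]
    by (auto simp: H_coeff_def split: if_splits)
  have free: "v + int i \<in> prog n r (k + 1)" if "v \<in> shifts n s c d" "i < k" for v i
    using H_image_free_position[OF q card n(1) cop(1) r eq that] by simp
  show False
    using unit(1) k unit(2,3) V shifts_cong free cover by (rule prog_cover_contradiction)
qed

lemma H_image_twisted_contradiction:
  fixes c d :: "nat \<Rightarrow> 'a :: {field, finite}"
  assumes q: "primepow q" and card: "CARD('a) = q ^ n"
    and cop: "coprime n s" and r: "[int s * r = int t] (mod int n)"
    and unit: "coprime r (int n)" "\<not> [r = 1] (mod int n)" "\<not> [r = - 1] (mod int n)"
    and V: "shifts n s c d \<noteq> {}" and k: "2 < k" "k < n - 2" and \<eta>: "\<eta> \<noteq> 0"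
    and eq: "\<And>a. \<exists>b. \<forall>x. q_map q {..<n} 1 c (q_map q {..k} s (H_coeff q k \<eta> g a)
               (q_map q {..<n} 1 d x)) = q_map q {..<k + 1} t b x"
  shows False
proof -
  have n: "n > 0" "k > 0" using k by auto
  have free: "v + int i \<in> prog n r (k + 1)" if "v \<in> shifts n s c d" "0 < i" "i < k" for v i
    using H_image_free_position[OF q card n(1) cop r eq] that by simp
  note ends = H_image_end_position[OF q card n(1) cop r eq _ n(2)]
  show False
    using unit(1) k unit(2,3) V free ends(1) ends(2)[OF _ \<eta>] by (rule prog_twisted_contradiction)
qed

theorem theorem4p7:
  fixes q n k s t g h l :: nat
    and \<eta> \<theta> :: "'a :: {field, finite}"
  assumes "primepow q"
    and "CARD('a) = q ^ n"
    and "n > 0" "k > 0" "s > 0" "t > 0" "g > 0" "h > 0" "l > 0"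
    and "coprime n s" "coprime n t"
    and "[s = l * t] (mod n)"
    and "q_norm q n s \<eta> \<noteq> (- 1) ^ (n * k)"
    and "q_norm q n t \<theta> \<noteq> (- 1) ^ (n * k)"
    and "\<not> [int s = int t] (mod int n)"
    and "\<not> [int s = - int t] (mod int n)"
  shows "(\<eta> = 0 \<and> \<theta> = 0 \<and> 1 < k \<and> k < n - 1 \<longrightarrow>
            \<not> code_equiv q n (H_code q n k s \<eta> g) (H_code q n k t \<theta> h)) \<and>
         (\<eta> = 0 \<and> \<theta> \<noteq> 0 \<and> 2 < k \<and> k < n - 2 \<longrightarrow>
            \<not> code_equiv q n (H_code q n k s \<eta> g) (H_code q n k t \<theta> h)) \<and>
         (\<eta> \<noteq> 0 \<and> \<theta> \<noteq> 0 \<and> 2 < k \<and> k < n - 2 \<longrightarrow>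
            \<not> code_equiv q n (H_code q n k s \<eta> g) (H_code q n k t \<theta> h))"
proof -
  note q = assms(1) and card = assms(2) and cop = assms(10,11)
  obtain r where r: "[int s * r = int t] (mod int n)" and unit: "coprime r (int n)"
      "\<not> [r = 1] (mod int n)" "\<not> [r = - 1] (mod int n)"
    using ratio_not_unit[OF cop assms(15,16)] .
  have False
    if equiv: "code_equiv q n (H_code q n k s \<eta> g) (H_code q n k t \<theta> h)"
      and range: "\<eta> = 0 \<and> \<theta> = 0 \<and> 1 < k \<and> k < n - 1 \<or> \<theta> \<noteq> 0 \<and> 2 < k \<and> k < n - 2"
  proof -
    obtain c d \<eta>' j m where cd: "j < n" "c j \<noteq> 0" "m < n" "d m \<noteq> 0" and \<eta>': "\<eta>' = 0 \<longleftrightarrow> \<eta> = 0"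
      and into: "\<And>a. \<exists>b. \<forall>x. q_map q {..<n} 1 c (q_map q {..k} s (H_coeff q k \<eta>' g a) (q_map q {..<n} 1 d x))
       = q_map q {..k} t (H_coeff q k \<theta> h b) x"
      and onto: "\<And>b. \<exists>a. \<forall>x. q_map q {..<n} 1 c (q_map q {..k} s (H_coeff q k \<eta>' g a) (q_map q {..<n} 1 d x))
       = q_map q {..k} t (H_coeff q k \<theta> h b) x"
      using equiv by (rule code_equivE[OF card]) blast
    \<comment> \<open>Fixing \<open>t\<close> in the rule truncates only the target side, to
      \<open>k\<close> or \<open>k + 1\<close> terms.\<close>
    note into = into[unfolded q_map_H_coeff_truncate[of q k t]]
      and onto = onto[unfolded q_map_H_coeff_truncate[of q k t]]
    have V: "shifts n s c d \<noteq> {}" using cop(1) cd by (rule shifts_nonempty)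
    consider (untwisted) "\<theta> = 0" | (mixed) "\<theta> \<noteq> 0" "\<eta> = 0" | (twisted) "\<theta> \<noteq> 0" "\<eta> \<noteq> 0"
      by blast
    then show False
    proof cases
      case untwisted
      then have "\<eta>' = 0" "1 < k" "k < n - 1" using range \<eta>' by auto
      have "\<exists>b. \<forall>x. q_map q {..<n} 1 c (q_map q {..k} s (H_coeff q k 0 g a) (q_map q {..<n} 1 d x))
           = q_map q {..<k} t b x" for a
        using into[of a] unfolding untwisted \<open>\<eta>' = 0\<close> by auto
      with q card cop(1) r unit V \<open>1 < k\<close> \<open>k < n - 1\<close> show False
        by (rule H_image_untwisted_contradiction)
    next
      case mixed
      then have "\<eta>' = 0" and k: "2 < k" "k < n - 2" using range \<eta>' by auto
      have into': "\<exists>b. \<forall>x. q_map q {..<n} 1 c (q_map q {..k} s (H_coeff q k 0 g a) (q_map q {..<n} 1 d x))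
           = q_map q {..<k + 1} t b x" for a
        using into[of a] mixed(1) unfolding \<open>\<eta>' = 0\<close> by auto
      \<comment> \<open>The target element with all free coefficients 1 has last coefficient
        \<open>\<theta>\<close>, so none of its coefficients vanishes.\<close>
      obtain a where a: "\<And>x. q_map q {..<n} 1 c (q_map q {..k} s (H_coeff q k 0 g a) (q_map q {..<n} 1 d x))
           = q_map q {..<k + 1} t (H_coeff q k \<theta> h (\<lambda>_. 1)) x"
        using onto[of "\<lambda>_. 1"] mixed(1) unfolding \<open>\<eta>' = 0\<close> by auto
      show False
        by (rule H_image_mixed_contradiction[OF q card cop r unit V k into' a])
           (use mixed in \<open>simp add: H_coeff_def\<close>)
    next
      case twisted
      then have "\<eta>' \<noteq> 0" and k: "2 < k" "k < n - 2" using range \<eta>' by auto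
      have "\<exists>b. \<forall>x. q_map q {..<n} 1 c (q_map q {..k} s (H_coeff q k \<eta>' g a) (q_map q {..<n} 1 d x))
           = q_map q {..<k + 1} t b x" for a
        using into[of a] twisted(1) by auto
      with q card cop(1) r unit V k \<open>\<eta>' \<noteq> 0\<close> show False
        by (rule H_image_twisted_contradiction)
    qed
  qed
  then show ?thesis by blast
qed

end
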